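(* Let $\mathbb{X}, \mathbb{Y}$ be real Banach spaces and let $\mathbb{Z} = \mathbb{X} \bigoplus_{\infty} \mathbb{Y}$. Then $(x,y) \in S_{\mathbb{Z}}$ is a left-symmetric point in $\mathbb{Z}$ if and only if at least one of the following is true: (i) $x \in S_{\mathbb{X}}$ is a left-symmetric point in $\mathbb{X}$ and $y = 0$; (ii) $x = 0$ and $y \in S_{\mathbb{Y}}$ is a left-symmetric point in $\mathbb{Y}$.
   Context: $\mathbb{X} \bigoplus_{\infty} \mathbb{Y}$ denotes the direct sum of $\mathbb{X}$ and $\mathbb{Y}$ endowed with the norm $\|(x,y)\| = \max\{\|x\|,\|y\|\}$. For a real Banach space $\mathbb{X}$, $S_{\mathbb{X}} = \{x \in \mathbb{X} : \|x\| = 1\}$. For $x,y$ in a real Banach space, $x$ is Birkhoff-James orthogonal to $y$, written $x \perp_B y$, if $\|x+\lambda y\| \geq \|x\|$ for all $\lambda \in \mathbb{R}$. An element $x$ of a real Banach space $\mathbb{X}$ is a left-symmetric point in $\mathbb{X}$ if for every $y \in \mathbb{X}$, $x \perp_B y$ implies $y \perp_B x$. *)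

theory Defs
  imports "HOL-Analysis.Analysis"
begin

text \<open>The product type of the library carries the Euclidean norm, so the direct sum with the
  maximum norm is a type of its own, whose elements are the pairs \<open>SupPair x y\<close>.\<close>

datatype ('a, 'b) sup_sum = SupPair (sup_fst: 'a) (sup_snd: 'b)

instantiation sup_sum :: (real_vector, real_vector) real_vector
begin

definition zero_sup_sum :: "('a, 'b) sup_sum"
  where "0 = SupPair 0 0"

definition plus_sup_sum :: "('a, 'b) sup_sum \<Rightarrow> ('a, 'b) sup_sum \<Rightarrow> ('a, 'b) sup_sum"
  where "p + q = SupPair (sup_fst p + sup_fst q) (sup_snd p + sup_snd q)"

definition minus_sup_sum :: "('a, 'b) sup_sum \<Rightarrow> ('a, 'b) sup_sum \<Rightarrow> ('a, 'b) sup_sum"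
  where "p - q = SupPair (sup_fst p - sup_fst q) (sup_snd p - sup_snd q)"

definition uminus_sup_sum :: "('a, 'b) sup_sum \<Rightarrow> ('a, 'b) sup_sum"
  where "- p = SupPair (- sup_fst p) (- sup_snd p)"

definition scaleR_sup_sum :: "real \<Rightarrow> ('a, 'b) sup_sum \<Rightarrow> ('a, 'b) sup_sum"
  where "r *\<^sub>R p = SupPair (r *\<^sub>R sup_fst p) (r *\<^sub>R sup_snd p)"

instance
  by standard
    (auto simp: zero_sup_sum_def plus_sup_sum_def minus_sup_sum_def uminus_sup_sum_def
      scaleR_sup_sum_def algebra_simps)

end

lemma sup_fst_simps [simp]:
  "sup_fst 0 = 0" "sup_fst (p + q) = sup_fst p + sup_fst q"
  "sup_fst (p - q) = sup_fst p - sup_fst q" "sup_fst (- p) = - sup_fst p"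
  "sup_fst (r *\<^sub>R p) = r *\<^sub>R sup_fst p"
  by (simp_all add: zero_sup_sum_def plus_sup_sum_def minus_sup_sum_def uminus_sup_sum_def
      scaleR_sup_sum_def)

lemma sup_snd_simps [simp]:
  "sup_snd 0 = 0" "sup_snd (p + q) = sup_snd p + sup_snd q"
  "sup_snd (p - q) = sup_snd p - sup_snd q" "sup_snd (- p) = - sup_snd p"
  "sup_snd (r *\<^sub>R p) = r *\<^sub>R sup_snd p"
  by (simp_all add: zero_sup_sum_def plus_sup_sum_def minus_sup_sum_def uminus_sup_sum_def
      scaleR_sup_sum_def)

instantiation sup_sum :: (real_normed_vector, real_normed_vector) real_normed_vector
begin

definition norm_sup_sum :: "('a, 'b) sup_sum \<Rightarrow> real"
  where "norm p = max (norm (sup_fst p)) (norm (sup_snd p))"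

definition sgn_sup_sum :: "('a, 'b) sup_sum \<Rightarrow> ('a, 'b) sup_sum"
  where "sgn_sup_sum p = p /\<^sub>R norm p"

definition dist_sup_sum :: "('a, 'b) sup_sum \<Rightarrow> ('a, 'b) sup_sum \<Rightarrow> real"
  where "dist_sup_sum p q = norm (p - q)"

definition uniformity_sup_sum :: "(('a, 'b) sup_sum \<times> ('a, 'b) sup_sum) filter"
  where "uniformity_sup_sum =
    (INF e\<in>{0 <..}. principal {(p :: ('a, 'b) sup_sum, q). dist p q < e})"

definition open_sup_sum :: "('a, 'b) sup_sum set \<Rightarrow> bool"
  where "open_sup_sum U \<longleftrightarrow>
    (\<forall>p\<in>U. eventually (\<lambda>(p', q). p' = p \<longrightarrow> q \<in> U) uniformity)"

instance
proof
  fix p q :: "('a, 'b) sup_sum" and r :: real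
  show "norm p = 0 \<longleftrightarrow> p = 0"
  proof
    assume "norm p = 0"
    then have "norm (sup_fst p) \<le> 0" "norm (sup_snd p) \<le> 0"
      unfolding norm_sup_sum_def by linarith+
    then show "p = 0" by (cases p) (simp add: zero_sup_sum_def)
  qed (simp add: norm_sup_sum_def)
  have "norm (sup_fst p + sup_fst q) \<le> norm (sup_fst p) + norm (sup_fst q)"
    "norm (sup_snd p + sup_snd q) \<le> norm (sup_snd p) + norm (sup_snd q)"
    by (rule norm_triangle_ineq)+
  then show "norm (p + q) \<le> norm p + norm q"
    unfolding norm_sup_sum_def sup_fst_simps sup_snd_simps by linarith
  show "norm (r *\<^sub>R p) = \<bar>r\<bar> * norm p"
    by (simp add: norm_sup_sum_def max_mult_distrib_left)
qed (rule sgn_sup_sum_def dist_sup_sum_def uniformity_sup_sum_def open_sup_sum_def)+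

end

instance sup_sum :: (banach, banach) banach
proof
  fix X :: "nat \<Rightarrow> ('a, 'b) sup_sum"
  assume X: "Cauchy X"
  have le: "dist (sup_fst p) (sup_fst q) \<le> dist p q" "dist (sup_snd p) (sup_snd q) \<le> dist p q"
    for p q :: "('a, 'b) sup_sum"
    by (simp_all add: dist_norm norm_sup_sum_def)
  have "Cauchy (\<lambda>n. sup_fst (X n))" "Cauchy (\<lambda>n. sup_snd (X n))"
    using X unfolding Cauchy_def by (meson le le_less_trans)+
  then obtain a b where "(\<lambda>n. sup_fst (X n)) \<longlonglongrightarrow> a" "(\<lambda>n. sup_snd (X n)) \<longlonglongrightarrow> b"
    using Cauchy_convergent_iff convergent_def by metis
  then have "(\<lambda>n. max (norm (sup_fst (X n) - a)) (norm (sup_snd (X n) - b))) \<longlonglongrightarrow> max 0 0"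
    by (intro tendsto_max) (simp_all add: LIM_zero tendsto_norm_zero)
  then have "(\<lambda>n. norm (X n - SupPair a b)) \<longlonglongrightarrow> 0"
    by (simp add: norm_sup_sum_def)
  then have "X \<longlonglongrightarrow> SupPair a b"
    by (simp add: tendsto_norm_zero_iff LIM_zero_iff)
  then show "convergent X" by (rule convergentI)
qed

definition bj_orthogonal :: "'a::real_normed_vector \<Rightarrow> 'a \<Rightarrow> bool"  (infix \<open>\<bottom>\<^sub>B\<close> 50)
  where "x \<bottom>\<^sub>B y \<longleftrightarrow> (\<forall>t::real. norm (x + t *\<^sub>R y) \<ge> norm x)"

definition left_symmetric_point :: "'a::real_normed_vector \<Rightarrow> bool"
  where "left_symmetric_point x \<longleftrightarrow> (\<forall>y. x \<bottom>\<^sub>B y \<longrightarrow> y \<bottom>\<^sub>B x)"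

end

theory Submission
  imports Defs
begin

text \<open>If \<open>x\<close> has norm 1, then \<open>(x, y)\<close> is orthogonal to \<open>(0, y)\<close>, whereas for \<open>y \<noteq> 0\<close> a small
  negative multiple of \<open>(x, y)\<close> added to \<open>(0, y)\<close> decreases the norm; so a left-symmetric unit
  vector has one component zero. For \<open>y = 0\<close> the second component does not matter: orthogonality
  is a local condition by convexity, and near \<open>(x, 0)\<close> the norm is that of the first component.\<close>

lemma norm_SupPair [simp]: "norm (SupPair x y) = max (norm x) (norm y)"
  by (simp add: norm_sup_sum_def)

lemma SupPair_add_scaleR [simp]:
  "SupPair x y + t *\<^sub>R SupPair u v = SupPair (x + t *\<^sub>R u) (y + t *\<^sub>R v)"
  by (simp add: plus_sup_sum_def scaleR_sup_sum_def)

lemma left_symmetric_point_SupPair: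
  "left_symmetric_point (SupPair x y) \<longleftrightarrow>
    (\<forall>u v. SupPair x y \<bottom>\<^sub>B SupPair u v \<longrightarrow> SupPair u v \<bottom>\<^sub>B SupPair x y)"
  unfolding left_symmetric_point_def by (metis sup_sum.exhaust)

lemma left_symmetric_point_swap:
  "left_symmetric_point (SupPair x y) \<longleftrightarrow> left_symmetric_point (SupPair y x)"
  unfolding left_symmetric_point_SupPair bj_orthogonal_def norm_SupPair SupPair_add_scaleR
  by (metis max.commute)

text \<open>The map \<open>t \<mapsto> norm (x + t *\<^sub>R u)\<close> is convex, so a value below
  \<open>norm x\<close> at one \<open>t\<close> forces values below \<open>norm x\<close> on the
  whole way from \<open>t\<close> towards \<open>0\<close>, hence also within distance
  \<open>e\<close> of \<open>0\<close>.\<close>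

lemma bj_orthogonal_localI:
  assumes "e > 0" and local: "\<And>t. \<bar>t\<bar> < e \<Longrightarrow> norm x \<le> norm (x + t *\<^sub>R u)"
  shows "x \<bottom>\<^sub>B u"
  unfolding bj_orthogonal_def
proof (intro allI leI notI)
  fix t assume less: "norm (x + t *\<^sub>R u) < norm x"
  \<comment> \<open>This scales \<open>t\<close> into the local range:
    \<open>\<bar>s * t\<bar>\<close> is \<open>e\<close> times a factor below 1.\<close>
  define s where "s = e / (e + \<bar>t\<bar>)"
  have s: "0 < s" "s \<le> 1"
    using \<open>e > 0\<close> by (auto simp: s_def divide_simps)
  have "t \<noteq> 0"
    using less by auto
  then have "\<bar>s * t\<bar> < e"
    using \<open>e > 0\<close> by (simp add: s_def abs_mult divide_simps)
  then have "norm x \<le> norm (x + (s * t) *\<^sub>R u)"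
    by (rule local)
  also have "x + (s * t) *\<^sub>R u = (1 - s) *\<^sub>R x + s *\<^sub>R (x + t *\<^sub>R u)"
    by (simp add: algebra_simps)
  also have "norm \<dots> \<le> (1 - s) * norm x + s * norm (x + t *\<^sub>R u)"
    using s by (intro norm_triangle_le) simp
  also have "\<dots> < (1 - s) * norm x + s * norm x"
    using s less by simp
  finally show False
    by (simp add: algebra_simps)
qed

lemma SupPair_zero_bj_orthogonal_iff:
  assumes "x \<noteq> 0"
  shows "SupPair x 0 \<bottom>\<^sub>B SupPair u v \<longleftrightarrow> x \<bottom>\<^sub>B u"
proof
  assume orth: "SupPair x 0 \<bottom>\<^sub>B SupPair u v"
  show "x \<bottom>\<^sub>B u"
  proof (rule bj_orthogonal_localI)
    \<comment> \<open>Within this radius \<open>t *\<^sub>R v\<close> stays shorter than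
      \<open>x\<close>, so the first component must carry the norm; the added 1 covers
      \<open>v = 0\<close>.\<close>
    show "norm x / (norm v + 1) > 0"
      using assms by (simp add: add_nonneg_pos)
    fix t assume "\<bar>t\<bar> < norm x / (norm v + 1)"
    then have "\<bar>t\<bar> * (norm v + 1) < norm x"
      by (simp add: less_divide_eq add_nonneg_pos)
    then have "\<bar>t\<bar> * norm v < norm x"
      by (simp add: algebra_simps)
    moreover have "norm x \<le> max (norm (x + t *\<^sub>R u)) (\<bar>t\<bar> * norm v)"
      using orth unfolding bj_orthogonal_def by simp
    ultimately show "norm x \<le> norm (x + t *\<^sub>R u)"
      by linarith
  qed
qed (simp add: bj_orthogonal_def le_max_iff_disj)

lemma left_symmetric_point_SupPair_zero_iff:
  assumes "x \<noteq> 0"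
  shows "left_symmetric_point (SupPair x (0 :: 'b::real_normed_vector)) \<longleftrightarrow>
    left_symmetric_point x"
proof
  assume sym: "left_symmetric_point (SupPair x (0 :: 'b))"
  show "left_symmetric_point x"
    unfolding left_symmetric_point_def
  proof (intro allI impI)
    fix u assume "x \<bottom>\<^sub>B u"
    then have "SupPair u (0 :: 'b) \<bottom>\<^sub>B SupPair x 0"
      using sym SupPair_zero_bj_orthogonal_iff [OF assms] left_symmetric_point_def by blast
    then show "u \<bottom>\<^sub>B x"
      by (simp add: bj_orthogonal_def)
  qed
next
  assume sym: "left_symmetric_point x"
  \<comment> \<open>Adding multiples of \<open>SupPair x 0\<close> leaves \<open>v\<close> fixed and
    never makes the first component shorter than \<open>u\<close>.\<close>
  have "SupPair u v \<bottom>\<^sub>B SupPair x 0" if "u \<bottom>\<^sub>B x" for u and v :: 'b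
    using that by (auto simp: bj_orthogonal_def le_max_iff_disj intro: order_trans [of _ "norm u"])
  then show "left_symmetric_point (SupPair x (0 :: 'b))"
    using sym SupPair_zero_bj_orthogonal_iff [OF assms]
    unfolding left_symmetric_point_SupPair left_symmetric_point_def [of x] by blast
qed

lemma left_symmetric_point_SupPair_imp_zero:
  assumes sym: "left_symmetric_point (SupPair x y)"
    and le: "norm y \<le> norm x" and "x \<noteq> 0"
  shows "y = 0"
proof (rule ccontr)
  assume "y \<noteq> 0"
  \<comment> \<open>The first component stays \<open>x\<close>, which by \<open>le\<close> already
    attains the norm of the pair.\<close>
  have "SupPair x y \<bottom>\<^sub>B SupPair 0 y"
    using le by (simp add: bj_orthogonal_def le_max_iff_disj)
  then have orth: "SupPair 0 y \<bottom>\<^sub>B SupPair x y"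
    using sym by (simp add: left_symmetric_point_def)
  \<comment> \<open>Chosen so that \<open>s * norm x\<close> is half of \<open>norm y\<close>;
    \<open>le\<close> gives \<open>s \<le> 1/2\<close>.\<close>
  define s where "s = norm y / (2 * norm x)"
  have s: "0 < s" "s < 1" "s * norm x < norm y"
    using \<open>y \<noteq> 0\<close> \<open>x \<noteq> 0\<close> le by (auto simp: s_def divide_simps)
      (smt (verit) zero_less_norm_iff)
  \<comment> \<open>At the scalar \<open>- s\<close> both components are shorter than
    \<open>y\<close>, against orthogonality.\<close>
  have "norm y \<le> max (s * norm x) (norm (y + (- s) *\<^sub>R y))"
    using orth [unfolded bj_orthogonal_def SupPair_add_scaleR norm_SupPair, rule_format, of "- s"] s
    by simp
  also have "y + (- s) *\<^sub>R y = (1 - s) *\<^sub>R y"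
    by (simp add: algebra_simps)
  also have "norm ((1 - s) *\<^sub>R y) = (1 - s) * norm y"
    using s by simp
  finally have "norm y \<le> (1 - s) * norm y"
    using s by linarith
  then show False
    using s \<open>y \<noteq> 0\<close> by (simp add: algebra_simps mult_le_0_iff)
qed

theorem theorem2p4:
  fixes x :: "'a::banach" and y :: "'b::banach"
  shows "SupPair x y \<in> sphere 0 1 \<and> left_symmetric_point (SupPair x y) \<longleftrightarrow>
    (x \<in> sphere 0 1 \<and> left_symmetric_point x \<and> y = 0) \<or>
    (x = 0 \<and> y \<in> sphere 0 1 \<and> left_symmetric_point y)"
  (is "?L \<longleftrightarrow> ?R")
proof
  assume L: ?L
  \<comment> \<open>With both orders available, the component of norm 1 can be put first.\<close>
  then have sym: "left_symmetric_point (SupPair x y)" "left_symmetric_point (SupPair y x)"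
    by (simp_all add: left_symmetric_point_swap [of y])
  from L consider "norm x = 1" "norm y \<le> norm x" | "norm y = 1" "norm x \<le> norm y"
    by (auto simp: max_def split: if_splits)
  then show ?R
  proof cases
    case 1
    then have "x \<noteq> 0" by auto
    then show ?thesis
      using 1 sym left_symmetric_point_SupPair_imp_zero left_symmetric_point_SupPair_zero_iff
      by (metis mem_sphere_0)
  next
    case 2
    then have "y \<noteq> 0" by auto
    then show ?thesis
      using 2 sym left_symmetric_point_SupPair_imp_zero left_symmetric_point_SupPair_zero_iff
      by (metis mem_sphere_0)
  qed
next
  assume ?R
  then show ?L
  proof (elim disjE conjE)
    assume "x \<in> sphere 0 1" "left_symmetric_point x" "y = 0"
    moreover from this have "x \<noteq> 0" by auto
    ultimately show ?L
      by (simp add: left_symmetric_point_SupPair_zero_iff)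
  next
    assume "x = 0" "y \<in> sphere 0 1" "left_symmetric_point y"
    moreover from this have "y \<noteq> 0" by auto
    ultimately show ?L
      by (simp add: left_symmetric_point_SupPair_zero_iff left_symmetric_point_swap [of 0])
  qed
qed

end
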